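(* Let $n\geq 2$ be an integer and let $a,b\in\mathbb{N}$. Define the partition $\alpha=(a+b,a^{n-2})$. Then $\alpha$ (regarded as the $n$-tuple $(a+b,a,\ldots,a,0)$ with $n-2$ entries $a$ in the middle) is a nonnegative snake and satisfies $$\overline{s}_{\alpha}=x_{\Pi}^{a}\cdot\left(h_a^-h_b^+-h_{a-1}^-h_{b-1}^+\right).$$
   Context: $\mathbb{N}=\{0,1,2,\ldots\}$. Let $\mathbf{k}$ be a commutative ring and $\mathcal{L}=\mathbf{k}[x_1^{\pm1},\ldots,x_n^{\pm1}]$ the ring of Laurent polynomials. Put $x_\Pi=x_1x_2\cdots x_n$. In a tuple, $m^k$ stands for $m,\ldots,m$ ($k$ times). A snake is an $n$-tuple $\lambda=(\lambda_1,\ldots,\lambda_n)$ of integers with $\lambda_1\geq\lambda_2\geq\cdots\geq\lambda_n$; it is nonnegative if all its entries are $\geq 0$. Partitions with at most $n$ nonzero entries are identified with nonnegative snakes. For $\lambda\in\mathbb{Z}^n$, the alternant is $a_\lambda=\sum_{w\in\mathfrak{S}_n}(-1)^w x_{w(1)}^{\lambda_1}\cdots x_{w(n)}^{\lambda_n}\in\mathcal{L}$, where $\mathfrak{S}_n$ is the symmetric group and $(-1)^w$ is the sign of $w$. Let $\rho=(n-1,n-2,\ldots,1,0)$. For a snake $\lambda$, the Schur Laurent polynomial is $\overline{s}_\lambda=a_{\lambda+\rho}/a_\rho\in\mathcal{L}$ (well-defined because $a_\rho$ is a non-zero-divisor of $\mathcal{L}$ and divides $a_{\lambda+\rho}$ in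 $\mathcal{L}$). For $k\in\mathbb{Z}$, let $h_k$ be the complete homogeneous symmetric function of degree $k$ (with $h_0=1$ and $h_k=0$ for $k<0$), and set $h_k^+=h_k(x_1,\ldots,x_n)$ and $h_k^-=h_k(x_1^{-1},\ldots,x_n^{-1})$ in $\mathcal{L}$. *)

theory Defs
  imports
    "HOL-Library.Poly_Mapping"
    "HOL-Library.Multiset"
    "HOL-Combinatorics.Permutations"
begin

(* Laurent polynomials: finitely supported maps from exponent vectors (themselves finitely
   supported maps from variable indices to integers) to coefficients, with the convolution
   product of Poly_Mapping.  The type has one variable for each natural number; the ring in the
   n variables x_1, ..., x_n is the subring laurent_ring n below.  Everything is indexed from 0:
   the variable x_(i+1) of the usual notation has index i, for i < n. *)
type_synonym 'k laurent = "(nat \<Rightarrow>\<^sub>0 int) \<Rightarrow>\<^sub>0 'k"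

definition laurent_ring :: "nat \<Rightarrow> 'k::comm_ring_1 laurent set" where
  "laurent_ring n = {p. \<forall>e \<in> Poly_Mapping.keys p. Poly_Mapping.keys e \<subseteq> {..<n}}"

(* The integer power x_i^m of the i-th variable. *)
definition var_pow :: "nat \<Rightarrow> int \<Rightarrow> 'k::comm_ring_1 laurent" where
  "var_pow i m = Poly_Mapping.single (Poly_Mapping.single i m) 1"

lemma var_pow_0: "var_pow i 0 = 1"
  by (simp add: var_pow_def)

lemma var_pow_add: "var_pow i (l + m) = var_pow i l * var_pow i m"
  by (simp add: var_pow_def Poly_Mapping.mult_single Poly_Mapping.single_add)

definition x_Pi :: "nat \<Rightarrow> 'k::comm_ring_1 laurent" where
  "x_Pi n = (\<Prod>i<n. var_pow i 1)"

definition snake :: "nat \<Rightarrow> int list \<Rightarrow> bool" where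
  "snake n l \<longleftrightarrow> length l = n \<and> sorted_wrt (\<ge>) l"

definition nonneg_snake :: "nat \<Rightarrow> int list \<Rightarrow> bool" where
  "nonneg_snake n l \<longleftrightarrow> snake n l \<and> (\<forall>m \<in> set l. m \<ge> 0)"

definition alternant :: "nat \<Rightarrow> int list \<Rightarrow> 'k::comm_ring_1 laurent" where
  "alternant n l = (\<Sum>w | w permutes {..<n}. of_int (sign w) * (\<Prod>i<n. var_pow (w i) (l ! i)))"

definition rho :: "nat \<Rightarrow> int list" where
  "rho n = map (\<lambda>i. int n - 1 - int i) [0..<n]"

(* The quotient of two alternants is the unique Laurent polynomial whose product with the
   denominator is the numerator: alternant n (rho n) is a non-zero-divisor. *)
definition schur_laurent :: "nat \<Rightarrow> int list \<Rightarrow> 'k::comm_ring_1 laurent" where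
  "schur_laurent n l =
     (THE s. s \<in> laurent_ring n \<and> s * alternant n (rho n) = alternant n (map2 (+) l (rho n)))"

(* The complete homogeneous symmetric polynomial h_k evaluated at y 0, ..., y (n - 1): the
   monomials of degree k correspond to the multisets of size k of indices, so that the sum
   is empty for k < 0. *)
definition complete_hom :: "nat \<Rightarrow> (nat \<Rightarrow> 'a::comm_ring_1) \<Rightarrow> int \<Rightarrow> 'a" where
  "complete_hom n y k = (\<Sum>M | set_mset M \<subseteq> {..<n} \<and> int (size M) = k. \<Prod>i\<in>#M. y i)"

lemma finite_complete_hom_index: "finite {M. set_mset M \<subseteq> {..<n::nat} \<and> int (size M) = k}"
proof (rule finite_subset)
  show "{M. set_mset M \<subseteq> {..<n} \<and> int (size M) = k}
      \<subseteq> mset ` {xs. set xs \<subseteq> {..<n} \<and> length xs = nat k}"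
  proof
    fix M assume "M \<in> {M. set_mset M \<subseteq> {..<n} \<and> int (size M) = k}"
    moreover obtain xs where "mset xs = M" using ex_mset by blast
    ultimately show "M \<in> mset ` {xs. set xs \<subseteq> {..<n} \<and> length xs = nat k}" by force
  qed
qed (simp add: finite_lists_length_eq)

lemma complete_hom_0: "complete_hom n y 0 = 1"
proof -
  have "{M. set_mset M \<subseteq> {..<n} \<and> int (size M) = 0} = {{#}}" by auto
  then show ?thesis by (simp add: complete_hom_def)
qed

lemma complete_hom_neg: "k < 0 \<Longrightarrow> complete_hom n y k = 0"
  by (auto simp: complete_hom_def intro!: sum.neutral)

definition h_plus :: "nat \<Rightarrow> int \<Rightarrow> 'k::comm_ring_1 laurent" where
  "h_plus n k = complete_hom n (\<lambda>i. var_pow i 1) k"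

definition h_minus :: "nat \<Rightarrow> int \<Rightarrow> 'k::comm_ring_1 laurent" where
  "h_minus n k = complete_hom n (\<lambda>i. var_pow i (- 1)) k"

end

theory Submission
  imports Defs "Jordan_Normal_Form.Determinant"
begin

text \<open>
  Write \<open>P = (X - x\<^sub>1) \<cdots> (X - x\<^sub>n)\<close>. Dividing the alternant of \<open>\<alpha> + \<rho>\<close> by \<open>x\<^sub>\<Pi>\<^sup>a\<close> lowers all exponents by
  \<open>a\<close> and leaves the exponents \<open>b + n - 1, n - 2, \<dots>, 1, - a\<close>: only the first and the last row of the
  resulting determinant differ from those of the Vandermonde determinant \<open>a\<^sub>\<rho>\<close>.

  Both exceptional rows are explicit combinations of the Vandermonde rows. Reducing \<open>X\<^bsup>b+n-1\<^esup>\<close> modulo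
  \<open>P\<close> expresses every \<open>x\<^sub>i\<^bsup>b+n-1\<^esup>\<close> through \<open>x\<^sub>i\<^bsup>n-1\<^esup>, \<dots>, x\<^sub>i, 1\<close> with coefficients that do not depend
  on \<open>i\<close>. Since \<open>1/P\<close> expands as \<open>\<Sum>\<^sub>k h\<^sub>k\<^sup>+ X\<^bsup>-n-k\<^esup>\<close>, the quotient is \<open>\<Sum>\<^bsub>k<b\<^esub> h\<^sub>k\<^sup>+ X\<^bsup>b-1-k\<^esup>\<close>; hence the
  remainder has top coefficient \<open>h\<^sub>b\<^sup>+\<close> (\<open>coeff_hom_remainder_top\<close>) and constant coefficient
  \<open>- P(0) h\<^bsub>b-1\<^esub>\<^sup>+\<close> (\<open>coeff_hom_remainder_0\<close>). The same division for the inverse variables, with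
  polynomial \<open>P'\<close>, rewrites \<open>x\<^sub>i\<^bsup>-a\<^esup> = x\<^sub>i\<^bsup>n-1\<^esup> (x\<^sub>i\<^bsup>-1\<^esup>)\<^bsup>a+n-1\<^esup>\<close>, now with coefficient \<open>h\<^sub>a\<^sup>-\<close> at \<open>1\<close> and
  \<open>- P'(0) h\<^bsub>a-1\<^esub>\<^sup>-\<close> at \<open>x\<^sub>i\<^bsup>n-1\<^esup>\<close>.

  In a determinant whose first and last rows are combinations of the rows of another one, only the four
  coefficients at these two rows matter, through their \<open>2 \<times> 2\<close> determinant (\<open>leibniz_two_rows\<close>). Here it is
  \<open>h\<^sub>b\<^sup>+ h\<^sub>a\<^sup>- - P(0) P'(0) h\<^bsub>b-1\<^esub>\<^sup>+ h\<^bsub>a-1\<^esub>\<^sup>-\<close>, and \<open>P(0) P'(0) = 1\<close>.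

  So the right-hand side times \<open>a\<^sub>\<rho>\<close> is the numerator. That it is the quotient rests on \<open>a\<^sub>\<rho>\<close> being a
  non-zero-divisor over every coefficient ring: its lexicographically largest monomial has
  coefficient \<open>1\<close> (\<open>alternant_cancel\<close>).
\<close>

section \<open>Complete homogeneous polynomials under adjoining a variable\<close>

lemma complete_hom_0_vars:
  "complete_hom 0 y k = (if k = 0 then 1 else 0)"
proof (cases "k = 0")
  case True
  then show ?thesis by (simp add: complete_hom_0)
next
  case False
  then have "{M. set_mset M \<subseteq> {..<0::nat} \<and> int (size M) = k} = {}" by auto
  with False show ?thesis by (simp only: complete_hom_def) simp
qed

text \<open>
  The monomials of degree \<open>k\<close> in \<open>n + 1\<close> variables either avoid the last variable or are that variable
  times an arbitrary monomial of degree \<open>k - 1\<close>.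
\<close>

lemma complete_hom_Suc_vars:
  "complete_hom (Suc n) y k = complete_hom n y k + y n * complete_hom (Suc n) y (k - 1)"
proof -
  let ?S = "\<lambda>m k. {M. set_mset M \<subseteq> {..<m::nat} \<and> int (size M) = k}"
  have inj: "inj_on (add_mset n) (?S (Suc n) (k - 1))"
    by (auto simp: inj_on_def)
  have split: "?S (Suc n) k = ?S n k \<union> add_mset n ` ?S (Suc n) (k - 1)"
  proof (intro equalityI subsetI)
    fix M assume M: "M \<in> ?S (Suc n) k"
    show "M \<in> ?S n k \<union> add_mset n ` ?S (Suc n) (k - 1)"
    proof (cases "n \<in># M")
      case True
      then obtain M' where "M = add_mset n M'" by (auto dest: multi_member_split)
      then show ?thesis using M by auto
    next
      case False
      with M have "M \<in> ?S n k" by (auto simp: less_Suc_eq)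
      then show ?thesis by simp
    qed
  qed auto
  have "complete_hom (Suc n) y k =
      (\<Sum>M\<in>?S n k. \<Prod>i\<in>#M. y i) + (\<Sum>M\<in>add_mset n ` ?S (Suc n) (k - 1). \<Prod>i\<in>#M. y i)"
  proof -
    have "add_mset n M \<notin> ?S n k" for M by simp
    then have "?S n k \<inter> add_mset n ` ?S (Suc n) (k - 1) = {}" by blast
    then show ?thesis
      unfolding complete_hom_def split
      by (intro sum.union_disjoint finite_imageI finite_complete_hom_index)
  qed
  also have "(\<Sum>M\<in>add_mset n ` ?S (Suc n) (k - 1). \<Prod>i\<in>#M. y i)
      = y n * complete_hom (Suc n) y (k - 1)"
    by (simp add: sum.reindex[OF inj] complete_hom_def sum_distrib_left)
  finally show ?thesis by (simp add: complete_hom_def)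
qed

section \<open>Division of a power of X by the polynomial with roots y\<close>

definition root_poly :: "nat \<Rightarrow> (nat \<Rightarrow> 'a::comm_ring_1) \<Rightarrow> 'a poly" where
  "root_poly n y = (\<Prod>i<n. [:- y i, 1:])"

text \<open>
  The polynomial \<open>\<Sum>\<^bsub>k<b\<^esub> h\<^sub>k X\<^bsup>b-1-k\<^esup>\<close> in Horner form, which turns up as the quotient of \<open>X\<^bsup>b+n-1\<^esup>\<close> by
  \<open>root_poly n y\<close>.
\<close>

primrec hom_quotient :: "nat \<Rightarrow> (nat \<Rightarrow> 'a::comm_ring_1) \<Rightarrow> nat \<Rightarrow> 'a poly" where
  "hom_quotient n y 0 = 0"
| "hom_quotient n y (Suc b) = pCons (complete_hom n y (int b)) (hom_quotient n y b)"

definition hom_remainder :: "nat \<Rightarrow> (nat \<Rightarrow> 'a::comm_ring_1) \<Rightarrow> nat \<Rightarrow> 'a poly" where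
  "hom_remainder n y b = monom 1 (b + n - 1) - root_poly n y * hom_quotient n y b"

lemma hom_quotient_0_vars: "hom_quotient 0 y (Suc b) = monom 1 b"
proof (induction b)
  case 0
  show ?case by (simp add: complete_hom_0_vars)
next
  case (Suc b)
  have "hom_quotient 0 y (Suc (Suc b)) = pCons 0 (hom_quotient 0 y (Suc b))"
    by (simp add: complete_hom_0_vars)
  then show ?case by (simp only: Suc.IH monom_Suc)
qed

text \<open>
  The recursion of \<open>complete_hom\<close> in the number of variables, collected over all degrees. It lets one
  linear factor of \<open>root_poly\<close> be absorbed into the quotient, which is what the induction on the number of
  variables below needs.
\<close>

lemma hom_quotient_Suc_vars:
  "[:- y n, 1:] * hom_quotient (Suc n) y b
    = hom_quotient n y (Suc b) - [:complete_hom (Suc n) y (int b):]"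
proof (induction b)
  case 0
  show ?case by (simp add: complete_hom_0)
next
  case (Suc b)
  let ?h = "complete_hom (Suc n) y" and ?q = "hom_quotient (Suc n) y b"
  have "[:- y n, 1:] * hom_quotient (Suc n) y (Suc b)
      = pCons 0 ([:- y n, 1:] * ?q) + [:- y n * ?h (int b), ?h (int b):]"
    by (simp only: hom_quotient.simps mult_pCons_right[of "[:- y n, 1:]" "?h (int b)"] add.commute)
       simp
  also have "\<dots> = pCons 0 (hom_quotient n y (Suc b)) - [:y n * ?h (int b):]"
    by (simp only: Suc.IH) simp
  also have "\<dots> = hom_quotient n y (Suc (Suc b)) - [:?h (int (Suc b)):]"
    using complete_hom_Suc_vars[of n y "int (Suc b)"] by simp
  finally show ?case .
qed

lemma degree_root_poly: "degree (root_poly n y) \<le> n"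
  and coeff_root_poly: "coeff (root_poly n y) n = 1"
proof (induction n)
  case 0
  { case 1 show ?case by (simp add: root_poly_def) }
  { case 2 show ?case by (simp add: root_poly_def) }
next
  case (Suc n)
  have step: "root_poly (Suc n) y = pCons 0 (root_poly n y) - smult (y n) (root_poly n y)"
    by (simp add: root_poly_def mult.commute[of _ "[:- y n, 1:]"])
  { case 1 show ?case
      using Suc(1) unfolding step
      by (intro degree_diff_le) (auto intro: order.trans[OF degree_pCons_le]
          order.trans[OF degree_smult_le]) }
  { case 2 show ?case
      using Suc unfolding step by (simp add: coeff_eq_0) }
qed

lemma hom_remainder_Suc_vars:
  assumes "n > 0"
  shows "hom_remainder (Suc n) y b
    = hom_remainder n y (Suc b) + smult (complete_hom (Suc n) y (int b)) (root_poly n y)"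
proof -
  have "root_poly (Suc n) y * hom_quotient (Suc n) y b
      = root_poly n y * ([:- y n, 1:] * hom_quotient (Suc n) y b)"
    by (simp only: root_poly_def prod.lessThan_Suc mult.assoc)
  also have "\<dots> = root_poly n y * hom_quotient n y (Suc b)
      - smult (complete_hom (Suc n) y (int b)) (root_poly n y)"
    by (simp only: hom_quotient_Suc_vars right_diff_distrib) simp
  finally show ?thesis using assms by (simp add: hom_remainder_def)
qed

lemma hom_remainder_1_var: "hom_remainder (Suc 0) y b = [:complete_hom (Suc 0) y (int b):]"
proof -
  have "root_poly (Suc 0) y = [:- y 0, 1:]" by (simp add: root_poly_def)
  then have "hom_remainder (Suc 0) y b = monom 1 b - [:- y 0, 1:] * hom_quotient (Suc 0) y b"
    by (simp only: hom_remainder_def) simp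
  then show ?thesis
    by (simp only: hom_quotient_Suc_vars hom_quotient_0_vars) simp
qed

text \<open>
  Adjoining the variable \<open>y\<^sub>n\<close> adds \<open>h\<^sub>b\<close> times the monic polynomial \<open>root_poly n y\<close> of degree \<open>n\<close> to a
  remainder of smaller degree. Hence the degree grows by at most one and \<open>h\<^sub>b\<close> becomes the top coefficient.
\<close>

lemma degree_hom_remainder: "degree (hom_remainder (Suc m) y b) \<le> m"
  and coeff_hom_remainder_top: "coeff (hom_remainder (Suc m) y b) m = complete_hom (Suc m) y (int b)"
proof (induction m arbitrary: b)
  case 0
  { case 1 show ?case by (simp add: hom_remainder_1_var) }
  { case 2 show ?case by (simp add: hom_remainder_1_var) }
next
  case (Suc m)
  { case 1 show ?case
      using Suc(1)[of "Suc b"] degree_root_poly[of "Suc m" y]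
      unfolding hom_remainder_Suc_vars[OF zero_less_Suc]
      by (intro degree_add_le) (auto intro: order.trans[OF degree_smult_le]) }
  { case 2 show ?case
      using Suc(1)[of "Suc b"] coeff_root_poly[of "Suc m" y]
      unfolding hom_remainder_Suc_vars[OF zero_less_Suc]
      by (simp add: coeff_eq_0) }
qed

text \<open>
  The power \<open>X\<^bsup>b+n-1\<^esup>\<close> has no constant term once \<open>n \<ge> 2\<close>, so only the product of the constant terms of
  divisor and quotient remains. For \<open>b = 0\<close> the quotient is \<open>0\<close>, in agreement with \<open>h\<^bsub>-1\<^esub> = 0\<close>.
\<close>

lemma coeff_hom_remainder_0:
  assumes "n \<ge> 2"
  shows "coeff (hom_remainder n y b) 0 = - (\<Prod>i<n. - y i) * complete_hom n y (int b - 1)"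
proof -
  have "coeff (hom_quotient n y b) 0 = complete_hom n y (int b - 1)"
    by (cases b) (simp_all add: complete_hom_neg)
  moreover have "coeff (root_poly n y) 0 = (\<Prod>i<n. - y i)"
    by (simp add: root_poly_def poly_0_coeff_0[symmetric] poly_prod)
  ultimately show ?thesis
    using assms by (simp add: hom_remainder_def coeff_mult)
qed

lemma power_eq_hom_remainder:
  assumes "j < n"
  shows "y j ^ (b + n - 1) = (\<Sum>k<n. coeff (hom_remainder n y b) k * y j ^ k)"
proof -
  obtain m where n: "n = Suc m" using assms by (cases n) auto
  have "poly (root_poly n y) (y j) = 0"
    using assms by (auto simp: root_poly_def poly_prod intro!: prod_zero)
  then have "y j ^ (b + n - 1) = poly (hom_remainder n y b) (y j)"
    by (simp add: hom_remainder_def poly_monom)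
  also have "\<dots> = (\<Sum>k<n. coeff (hom_remainder n y b) k * y j ^ k)"
    unfolding poly_altdef using degree_hom_remainder[of m y b]
    by (intro sum.mono_neutral_left) (auto simp: n coeff_eq_0)
  finally show ?thesis .
qed

section \<open>Determinants with two replaced rows\<close>

text \<open>
  The determinant of the matrix with entries \<open>u i j\<close>, given by a function rather than by a matrix so that
  rows can be replaced by function update; alternants are instances by definition.
\<close>

definition leibniz :: "nat \<Rightarrow> (nat \<Rightarrow> nat \<Rightarrow> 'a::comm_ring_1) \<Rightarrow> 'a" where
  "leibniz n u = (\<Sum>w | w permutes {..<n}. of_int (sign w) * (\<Prod>i<n. u i (w i)))"

lemma leibniz_eq_det: "leibniz n u = det (mat n n (\<lambda>(i, j). u i j))"
  unfolding leibniz_def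
  by (subst det_def'[where n = n])
     (auto simp: lessThan_atLeast0 permutes_in_image intro!: sum.cong prod.cong dest: permutes_in_image)

lemma leibniz_cong:
  assumes "\<And>i j. i < n \<Longrightarrow> j < n \<Longrightarrow> u i j = v i j"
  shows "leibniz n u = leibniz n v"
  unfolding leibniz_eq_det using assms by (intro arg_cong[where f = det]) auto

lemma leibniz_equal_rows:
  assumes "p < n" "q < n" "p \<noteq> q" "u p = u q"
  shows "leibniz n u = 0"
  unfolding leibniz_eq_det
  by (rule det_identical_rows[of _ n p q]) (use assms in auto)

lemma leibniz_swap_rows:
  assumes "p < n" "q < n" "p \<noteq> q"
  shows "leibniz n (u(p := u q, q := u p)) = - leibniz n u"
proof -
  let ?A = "mat n n (\<lambda>(i, j). u i j)"
  have "mat n n (\<lambda>(i, j). (u(p := u q, q := u p)) i j) = swaprows p q ?A"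
    by (rule eq_matI) (use assms in auto)
  then show ?thesis
    using det_swaprows[of p n q ?A] assms by (simp only: leibniz_eq_det) simp
qed

lemma leibniz_linear:
  assumes "p < n"
  shows "leibniz n (u(p := (\<lambda>j. \<Sum>k\<in>K. c k * f k j))) = (\<Sum>k\<in>K. c k * leibniz n (u(p := f k)))"
proof -
  have split: "(\<Prod>i<n. (u(p := g)) i (w i)) = g (w p) * (\<Prod>i\<in>{..<n} - {p}. u i (w i))"
    for g w
    using assms by (simp add: prod.remove[of "{..<n}" p])
  show ?thesis
    unfolding leibniz_def split
    by (simp add: sum_distrib_left sum_distrib_right mult.assoc mult.left_commute)
       (rule sum.swap)
qed

text \<open>
  Expanding both rows by linearity gives determinants whose rows are all taken from \<open>u\<close>. Choosing a row
  other than \<open>p\<close> and \<open>q\<close>, or the same row for both places, makes two rows equal, so that only the original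
  matrix and the one with rows \<open>p\<close> and \<open>q\<close> exchanged survive.
\<close>

lemma leibniz_two_rows:
  assumes pq: "p < n" "q < n" "p \<noteq> q"
  shows "leibniz n (u(p := (\<lambda>j. \<Sum>k<n. c k * u k j), q := (\<lambda>j. \<Sum>k<n. d k * u k j)))
    = (c p * d q - c q * d p) * leibniz n u"
proof -
  define D where "D = (\<lambda>j. \<Sum>k<n. d k * u k j)"
  have D1: "leibniz n (u(q := D)) = d q * leibniz n u"
  proof -
    have "leibniz n (u(q := D)) = (\<Sum>k<n. d k * leibniz n (u(q := u k)))"
      unfolding D_def by (rule leibniz_linear[OF pq(2)])
    also have "\<dots> = (\<Sum>k<n. if k = q then d q * leibniz n u else 0)"
      using pq(2) leibniz_equal_rows[of _ n q "u(q := u _)"]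
      by (intro sum.cong) (auto simp: fun_upd_idem)
    finally show ?thesis using pq(2) by simp
  qed
  have D2: "leibniz n (u(p := u q, q := D)) = - (d p * leibniz n u)"
  proof -
    have "leibniz n (u(p := u q, q := D)) = (\<Sum>k<n. d k * leibniz n (u(p := u q, q := u k)))"
      unfolding D_def by (rule leibniz_linear[OF pq(2)])
    also have "\<dots> = (\<Sum>k<n. if k = p then - (d p * leibniz n u) else 0)"
    proof (intro sum.cong refl)
      fix k assume k: "k \<in> {..<n}"
      consider "k = p" | "k = q" | "k \<noteq> p" "k \<noteq> q" by blast
      then show "d k * leibniz n (u(p := u q, q := u k)) = (if k = p then - (d p * leibniz n u) else 0)"
      proof cases
        case 1
        then show ?thesis using leibniz_swap_rows[OF pq, of u] by simp
      next
        case 2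
        then show ?thesis using leibniz_equal_rows[OF pq, of "u(p := u q, q := u q)"] pq by simp
      next
        case 3
        then show ?thesis
          using leibniz_equal_rows[of k n q "u(p := u q, q := u k)"] pq k by simp
      qed
    qed
    finally show ?thesis using pq(1) by simp
  qed
  have "leibniz n (u(p := (\<lambda>j. \<Sum>k<n. c k * u k j), q := D))
      = leibniz n ((u(q := D))(p := (\<lambda>j. \<Sum>k<n. c k * u k j)))"
    using pq by (simp add: fun_upd_twist)
  also have "\<dots> = (\<Sum>k<n. c k * leibniz n (u(q := D, p := u k)))"
    by (rule leibniz_linear[OF pq(1)])
  also have "\<dots> = (\<Sum>k<n. (if k = p then c p * (d q * leibniz n u) else 0)
      + (if k = q then - (c q * (d p * leibniz n u)) else 0))"
  proof (intro sum.cong refl)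
    fix k assume k: "k \<in> {..<n}"
    consider "k = p" | "k = q" | "k \<noteq> p" "k \<noteq> q" by blast
    then show "c k * leibniz n (u(q := D, p := u k)) = (if k = p then c p * (d q * leibniz n u) else 0)
      + (if k = q then - (c q * (d p * leibniz n u)) else 0)"
    proof cases
      case 1
      then show ?thesis using D1 pq by (simp add: fun_upd_idem)
    next
      case 2
      then show ?thesis using D2 pq by (simp add: fun_upd_twist)
    next
      case 3
      then show ?thesis
        using leibniz_equal_rows[of k n p "u(q := D, p := u k)"] pq k by simp
    qed
  qed
  also have "\<dots> = (c p * d q - c q * d p) * leibniz n u"
    using pq by (simp add: sum.distrib algebra_simps)
  finally show ?thesis by (simp add: D_def)
qed


section \<open>The ring of Laurent polynomials in n variables\<close>

lemma laurent_ring_0: "0 \<in> laurent_ring n"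
  and laurent_ring_1: "1 \<in> laurent_ring n"
  by (simp_all add: laurent_ring_def)

lemma laurent_ring_add: "p \<in> laurent_ring n \<Longrightarrow> q \<in> laurent_ring n \<Longrightarrow> p + q \<in> laurent_ring n"
  unfolding laurent_ring_def using keys_add[of p q] by blast

lemma laurent_ring_diff:
  assumes "p \<in> laurent_ring n" "q \<in> laurent_ring n"
  shows "p - q \<in> laurent_ring n"
proof -
  have "Poly_Mapping.keys (p - q) \<subseteq> Poly_Mapping.keys p \<union> Poly_Mapping.keys q"
    by (auto simp: in_keys_iff lookup_minus)
  then show ?thesis using assms unfolding laurent_ring_def by blast
qed

lemma laurent_ring_mult:
  assumes "p \<in> laurent_ring n" "q \<in> laurent_ring n"
  shows "p * q \<in> laurent_ring n"
proof -
  have "Poly_Mapping.keys e \<subseteq> {..<n}" if "e \<in> Poly_Mapping.keys (p * q)" for e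
  proof -
    from that keys_mult[of p q] obtain f g
      where "e = f + g" "f \<in> Poly_Mapping.keys p" "g \<in> Poly_Mapping.keys q" by blast
    then show ?thesis
      using assms keys_add[of f g] unfolding laurent_ring_def by blast
  qed
  then show ?thesis by (simp add: laurent_ring_def)
qed

lemma laurent_ring_sum: "(\<And>i. i \<in> A \<Longrightarrow> f i \<in> laurent_ring n) \<Longrightarrow> sum f A \<in> laurent_ring n"
  by (induction A rule: infinite_finite_induct) (simp_all add: laurent_ring_0 laurent_ring_add)

lemma laurent_ring_prod: "(\<And>i. i \<in> A \<Longrightarrow> f i \<in> laurent_ring n) \<Longrightarrow> prod f A \<in> laurent_ring n"
  by (induction A rule: infinite_finite_induct) (simp_all add: laurent_ring_1 laurent_ring_mult)

lemma laurent_ring_power: "p \<in> laurent_ring n \<Longrightarrow> p ^ k \<in> laurent_ring n"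
  by (induction k) (simp_all add: laurent_ring_1 laurent_ring_mult)

lemma laurent_ring_prod_mset:
  "(\<And>i. i \<in># M \<Longrightarrow> f i \<in> laurent_ring n) \<Longrightarrow> (\<Prod>i\<in>#M. f i) \<in> laurent_ring n"
  by (induction M) (simp_all add: laurent_ring_1 laurent_ring_mult)

lemma laurent_ring_var_pow: "i < n \<Longrightarrow> var_pow i m \<in> laurent_ring n"
  by (auto simp: laurent_ring_def var_pow_def)

lemma laurent_ring_complete_hom:
  "(\<And>i. i < n \<Longrightarrow> y i \<in> laurent_ring m) \<Longrightarrow> complete_hom n y k \<in> laurent_ring m"
  unfolding complete_hom_def
  by (intro laurent_ring_sum laurent_ring_prod_mset) auto

section \<open>Alternants are non-zero-divisors\<close>

text \<open>
  Exponents form a linearly ordered group, so the product of the largest term of \<open>p\<close> with the largest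
  term \<open>m\<close> of \<open>q\<close> cannot be cancelled by any other product of terms. As the coefficient at \<open>m\<close> is \<open>1\<close>,
  the resulting coefficient is the leading coefficient of \<open>p\<close>, which works even if the coefficients have
  zero divisors.
\<close>

lemma monic_leading_term_cancel:
  fixes p q :: "'a::linordered_ab_group_add \<Rightarrow>\<^sub>0 'b::comm_ring_1"
  assumes q: "\<And>e. e \<in> Poly_Mapping.keys (q - Poly_Mapping.single m 1) \<Longrightarrow> e < m"
    and "p * q = 0"
  shows "p = 0"
proof (rule ccontr)
  assume "p \<noteq> 0"
  define M where "M = Max (Poly_Mapping.keys p)"
  define c where "c = Poly_Mapping.lookup p M"
  define p' where "p' = p - Poly_Mapping.single M c"
  define r where "r = q - Poly_Mapping.single m 1"
  have ne: "Poly_Mapping.keys p \<noteq> {}" using \<open>p \<noteq> 0\<close> by simp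
  then have M: "M \<in> Poly_Mapping.keys p" unfolding M_def by (intro Max_in) auto
  then have "c \<noteq> 0" by (simp add: c_def in_keys_iff)
  have le: "e \<le> M" if "e \<in> Poly_Mapping.keys p" for e
    using that unfolding M_def by (intro Max_ge) auto
  have p': "e < M" if "e \<in> Poly_Mapping.keys p'" for e
  proof -
    from that have "e \<noteq> M" "e \<in> Poly_Mapping.keys p"
      by (auto simp: p'_def c_def in_keys_iff lookup_minus lookup_single when_def split: if_splits)
    with le show ?thesis by (simp add: order.strict_iff_order)
  qed
  have r: "e < m" if "e \<in> Poly_Mapping.keys r" for e using that q by (simp add: r_def)
  have "M + m \<notin> Poly_Mapping.keys (p' * Poly_Mapping.single m 1)"
    using keys_mult[of p' "Poly_Mapping.single m 1"] p' by fastforce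
  moreover have "M + m \<notin> Poly_Mapping.keys (p * r)"
  proof
    assume "M + m \<in> Poly_Mapping.keys (p * r)"
    then obtain e f where "M + m = e + f" "e \<in> Poly_Mapping.keys p" "f \<in> Poly_Mapping.keys r"
      using keys_mult[of p r] by blast
    with add_le_less_mono[OF le r] show False by fastforce
  qed
  moreover have "p * q = Poly_Mapping.single (M + m) c + p' * Poly_Mapping.single m 1 + p * r"
  proof -
    have "p * q = p * Poly_Mapping.single m 1 + p * r"
      by (simp add: r_def algebra_simps)
    also have "p * Poly_Mapping.single m 1
        = Poly_Mapping.single M c * Poly_Mapping.single m 1 + p' * Poly_Mapping.single m 1"
      by (simp add: p'_def algebra_simps)
    finally show ?thesis by (simp add: mult_single)
  qed
  ultimately have "Poly_Mapping.lookup (p * q) (M + m) = c"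
    by (simp add: lookup_add in_keys_iff)
  with \<open>p * q = 0\<close> \<open>c \<noteq> 0\<close> show False by simp
qed

definition monom_exponent :: "nat \<Rightarrow> (nat \<Rightarrow> nat) \<Rightarrow> (nat \<Rightarrow> int) \<Rightarrow> (nat \<Rightarrow>\<^sub>0 int)" where
  "monom_exponent n w l = (\<Sum>i<n. Poly_Mapping.single (w i) (l i))"

lemma prod_var_pow: "(\<Prod>i<n. var_pow (w i) (l i)) = Poly_Mapping.single (monom_exponent n w l) 1"
  by (induction n) (simp_all add: monom_exponent_def var_pow_def mult_single)

lemma lookup_monom_exponent:
  assumes "w permutes {..<n}" "i < n"
  shows "Poly_Mapping.lookup (monom_exponent n w l) (w i) = l i"
proof -
  have "Poly_Mapping.lookup (monom_exponent n w l) (w i) = (\<Sum>k<n. if k = i then l k else 0)"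
    unfolding monom_exponent_def lookup_sum
    using permutes_inj[OF assms(1)]
    by (intro sum.cong) (auto simp: lookup_single when_def inj_eq)
  then show ?thesis using assms(2) by simp
qed

text \<open>
  The order on exponents is lexicographic, with the variable of index \<open>0\<close> the most significant. At the
  first variable moved by \<open>w\<close>, the larger exponents are used up by the earlier, fixed variables, so its
  exponent can only be a later and hence smaller entry of \<open>l\<close>.
\<close>

lemma monom_exponent_less:
  assumes w: "w permutes {..<n}" "w \<noteq> id"
    and l: "\<And>i j. i < j \<Longrightarrow> j < n \<Longrightarrow> l j < l i"
  shows "monom_exponent n w l < monom_exponent n id l"
proof -
  define v where "v = Hilbert_Choice.inv w"
  have v: "v permutes {..<n}" using w(1) by (simp add: v_def permutes_inv)
  have wv: "w (v j) = j" for j using w(1) by (simp add: v_def permutes_inverses)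
  have look: "Poly_Mapping.lookup (monom_exponent n w l) j = l (v j)" if "j < n" for j
    using lookup_monom_exponent[OF w(1), of "v j" l] that permutes_in_image[OF v, of j]
    by (simp add: wv)
  have look_id: "Poly_Mapping.lookup (monom_exponent n id l) j = l j" if "j < n" for j
    using lookup_monom_exponent[OF permutes_id, of j n l] that by simp
  have "\<exists>k. v k \<noteq> k" using w(2) wv by (metis eq_id_iff)
  define k where "k = (LEAST k. v k \<noteq> k)"
  have k: "v k \<noteq> k" using LeastI_ex[OF \<open>\<exists>k. v k \<noteq> k\<close>] by (simp add: k_def)
  have below: "v j = j" if "j < k" for j using not_less_Least that unfolding k_def by blast
  have "k < n" using k v by (meson lessThan_iff permutes_not_in)
  then have "v k < n" using permutes_in_image[OF v, of k] by simp
  have "k < v k"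
  proof (rule ccontr)
    assume "\<not> k < v k"
    with k have "v k < k" by simp
    then have "v (v k) = v k" by (rule below)
    then show False using k permutes_inj[OF v] by (simp add: inj_eq)
  qed
  have "less_fun (Poly_Mapping.lookup (monom_exponent n w l)) (Poly_Mapping.lookup (monom_exponent n id l))"
    unfolding less_fun_def
  proof (intro exI[of _ k] conjI allI impI)
    show "Poly_Mapping.lookup (monom_exponent n w l) k < Poly_Mapping.lookup (monom_exponent n id l) k"
      using look[OF \<open>k < n\<close>] look_id[OF \<open>k < n\<close>] l[OF \<open>k < v k\<close> \<open>v k < n\<close>] by simp
    fix j assume "j < k"
    then show "Poly_Mapping.lookup (monom_exponent n w l) j = Poly_Mapping.lookup (monom_exponent n id l) j"
      using look look_id below \<open>k < n\<close> by simp
  qed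
  then show ?thesis by (simp add: less_poly_mapping.rep_eq)
qed

lemma alternant_cancel:
  fixes p :: "'k::comm_ring_1 laurent"
  assumes l: "\<And>i j. i < j \<Longrightarrow> j < n \<Longrightarrow> l ! j < l ! i"
    and "p * alternant n l = 0"
  shows "p = 0"
proof (rule monic_leading_term_cancel[OF _ assms(2)])
  let ?e = "\<lambda>w. monom_exponent n w (\<lambda>i. l ! i)"
  let ?t = "\<lambda>w. of_int (sign w) * Poly_Mapping.single (?e w) 1 :: 'k laurent"
  let ?W = "{w. w permutes {..<n}}"
  have id: "id \<in> ?W" and fin: "finite ?W" by (simp_all add: permutes_id finite_permutations)
  have "alternant n l = (\<Sum>w\<in>?W. ?t w)"
    by (simp add: alternant_def prod_var_pow)
  also have "\<dots> = Poly_Mapping.single (?e id) 1 + (\<Sum>w\<in>?W - {id}. ?t w)"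
    using sum.remove[OF fin id, of ?t] by simp
  finally have diff: "alternant n l - Poly_Mapping.single (?e id) 1 = (\<Sum>w\<in>?W - {id}. ?t w)"
    by simp
  fix e assume "e \<in> Poly_Mapping.keys (alternant n l - Poly_Mapping.single (?e id) (1 :: 'k))"
  then have "(\<Sum>w\<in>?W - {id}. Poly_Mapping.lookup (?t w) e) \<noteq> 0"
    unfolding diff by (simp add: in_keys_iff lookup_sum)
  then obtain w where w: "w \<in> ?W - {id}" "Poly_Mapping.lookup (?t w) e \<noteq> 0"
    by (meson sum.not_neutral_contains_not_neutral)
  from w(2) have "e = ?e w"
    by (auto simp: sign_def lookup_single when_def split: if_splits)
  then show "e < ?e id" using w(1) l by (auto intro: monom_exponent_less)
qed

lemma schur_laurent_eqI:
  fixes s :: "'k::comm_ring_1 laurent"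
  assumes s: "s \<in> laurent_ring n"
    and eq: "s * alternant n (rho n) = alternant n (map2 (+) l (rho n))"
  shows "schur_laurent n l = s"
  unfolding schur_laurent_def
proof (rule the_equality)
  fix t :: "'k laurent"
  assume "t \<in> laurent_ring n \<and> t * alternant n (rho n) = alternant n (map2 (+) l (rho n))"
  then have "(t - s) * alternant n (rho n) = 0"
    using eq by (simp add: left_diff_distrib)
  then have "t - s = 0"
    by (rule alternant_cancel[rotated]) (simp add: rho_def)
  then show "t = s" by simp
qed (use assms in simp)

lemma var_pow_power: "var_pow i m ^ k = var_pow i (int k * m)"
  by (induction k) (simp_all add: var_pow_0 var_pow_add[symmetric] algebra_simps)

section \<open>Reduction to the Vandermonde determinant\<close>

lemma alternant_eq_leibniz: "alternant n l = leibniz n (\<lambda>i j. var_pow j (l ! i))"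
  by (simp add: alternant_def leibniz_def)

lemma leibniz_var_pow_add_const:
  "leibniz n (\<lambda>i j. var_pow j (l i + int a))
    = (x_Pi n ^ a * leibniz n (\<lambda>i j. var_pow j (l i)) :: 'k::comm_ring_1 laurent)"
proof -
  have "(\<Prod>i<n. var_pow (w i) (l i + int a))
      = (x_Pi n ^ a * (\<Prod>i<n. var_pow (w i) (l i)) :: 'k laurent)"
    if "w permutes {..<n}" for w
  proof -
    have "(\<Prod>i<n. var_pow (w i) (int a) :: 'k laurent) = (\<Prod>i<n. var_pow i (int a))"
      using permutes_imp_bij[OF that]
      by (intro prod.reindex_bij_betw[of w "{..<n}" "{..<n}"])
    also have "\<dots> = x_Pi n ^ a"
      by (simp add: x_Pi_def prod_power_distrib var_pow_power)
    finally show ?thesis by (simp add: var_pow_add prod.distrib mult.commute)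
  qed
  then show ?thesis
    by (simp add: leibniz_def sum_distrib_left mult.left_commute)
qed

text \<open>
  The case of the snake \<open>(b, 0, \<dots>, 0, - a)\<close>, to which the theorem reduces after dividing by \<open>x\<^sub>\<Pi>\<^sup>a\<close>.
\<close>

lemma vandermonde_replace_outer_rows:
  assumes n: "n \<ge> 2"
  shows "leibniz n ((\<lambda>i j. var_pow j (int (n - 1 - i)))
        (0 := (\<lambda>j. var_pow j (int (b + n - 1))), n - 1 := (\<lambda>j. var_pow j (- int a))))
    = (h_minus n (int a) * h_plus n (int b) - h_minus n (int a - 1) * h_plus n (int b - 1))
      * leibniz n (\<lambda>i j. var_pow j (int (n - 1 - i)) :: 'k::comm_ring_1 laurent)"
proof -
  define y z :: "nat \<Rightarrow> 'k laurent" where "y = (\<lambda>i. var_pow i 1)" and "z = (\<lambda>i. var_pow i (- 1))"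
  define u :: "nat \<Rightarrow> nat \<Rightarrow> 'k laurent" where "u = (\<lambda>i j. var_pow j (int (n - 1 - i)))"
  \<comment> \<open>Row \<open>k\<close> holds the power \<open>n - 1 - k\<close>. The division for the inverse variables is used after
    multiplication by \<open>y j ^ (n - 1)\<close>, which turns \<open>z j ^ k\<close> into row \<open>k\<close> and so undoes the reversal.\<close>
  define c where "c = (\<lambda>k. coeff (hom_remainder n y b) (n - 1 - k))"
  define d where "d = (\<lambda>k. coeff (hom_remainder n z a) k)"
  obtain m where m: "n = Suc m" using n by (cases n) auto
  have ypow: "y j ^ k = var_pow j (int k)" and zpow: "z j ^ k = var_pow j (- int k)" for j k
    by (simp_all add: y_def z_def var_pow_power)
  have top: "var_pow j (int (b + n - 1)) = (\<Sum>k<n. c k * u k j)" if "j < n" for j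
  proof -
    have "var_pow j (int (b + n - 1)) = y j ^ (b + n - 1)" by (simp add: ypow)
    also have "\<dots> = (\<Sum>k<n. coeff (hom_remainder n y b) k * y j ^ k)"
      by (rule power_eq_hom_remainder[OF that])
    also have "\<dots> = (\<Sum>k<n. c k * u k j)"
      by (subst sum.nat_diff_reindex[symmetric]) (simp add: c_def u_def ypow)
    finally show ?thesis .
  qed
  have bottom: "var_pow j (- int a) = (\<Sum>k<n. d k * u k j)" if "j < n" for j
  proof -
    have "var_pow j (- int a) = z j ^ (a + n - 1) * var_pow j (int (n - 1))"
      using n by (simp add: zpow var_pow_add[symmetric] of_nat_diff)
    also have "\<dots> = (\<Sum>k<n. d k * (z j ^ k * var_pow j (int (n - 1))))"
      by (simp only: power_eq_hom_remainder[OF that] d_def sum_distrib_right mult.assoc)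
    also have "\<dots> = (\<Sum>k<n. d k * u k j)"
      by (intro sum.cong) (auto simp: zpow var_pow_add[symmetric] u_def of_nat_diff algebra_simps)
    finally show ?thesis .
  qed
  have "leibniz n (u(0 := (\<lambda>j. var_pow j (int (b + n - 1))), n - 1 := (\<lambda>j. var_pow j (- int a))))
      = leibniz n (u(0 := (\<lambda>j. \<Sum>k<n. c k * u k j), n - 1 := (\<lambda>j. \<Sum>k<n. d k * u k j)))"
    by (rule leibniz_cong) (auto simp only: fun_upd_apply top bottom split: if_split)
  also have "\<dots> = (c 0 * d (n - 1) - c (n - 1) * d 0) * leibniz n u"
    using n by (intro leibniz_two_rows) auto
  also have "c 0 = h_plus n (int b)"
    unfolding c_def h_plus_def using coeff_hom_remainder_top[of m y b] by (simp add: m y_def)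
  also have "d (n - 1) = h_minus n (int a)"
    unfolding d_def h_minus_def using coeff_hom_remainder_top[of m z a] by (simp add: m z_def)
  also have "c (n - 1) * d 0 = h_plus n (int b - 1) * h_minus n (int a - 1)"
  proof -
    have "(\<Prod>i<n. - y i) * (\<Prod>i<n. - z i) = 1"
      by (simp add: prod.distrib[symmetric] y_def z_def var_pow_add[symmetric] var_pow_0)
    then have "(- (\<Prod>i<n. - y i) * hp) * (- (\<Prod>i<n. - z i) * hm) = hp * hm" for hp hm
      by (metis (no_types, lifting) minus_mult_minus mult.assoc mult.left_commute mult_1 mult_minus_left)
    then show ?thesis
      by (simp only: c_def d_def diff_self_eq_0 coeff_hom_remainder_0[OF n] h_plus_def h_minus_def y_def z_def)
  qed
  finally show ?thesis unfolding u_def by (simp only: mult.commute[of "h_plus n _"])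
qed

theorem corollary4p30:
  fixes n a b :: nat and \<alpha> :: "int list"
  assumes "n \<ge> 2"
    and "\<alpha> = [int (a + b)] @ replicate (n - 2) (int a) @ [0]"
  shows "nonneg_snake n \<alpha> \<and>
    (schur_laurent n \<alpha> :: 'k::comm_ring_1 laurent) =
      x_Pi n ^ a *
        (h_minus n (int a) * h_plus n (int b) - h_minus n (int a - 1) * h_plus n (int b - 1))"
proof
  have len: "length \<alpha> = n" using assms by simp
  show "nonneg_snake n \<alpha>"
  proof -
    have "sorted_wrt (\<ge>) (replicate k (int a))" for k
      by (induction k) auto
    then show ?thesis
      using assms len by (auto simp: nonneg_snake_def snake_def sorted_wrt_append)
  qed
  have \<alpha>: "\<alpha> ! i = (if i = 0 then int (a + b) else if i = n - 1 then 0 else int a)" if "i < n" for i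
    using that assms by (auto simp: nth_append nth_Cons')
  let ?s = "x_Pi n ^ a * (h_minus n (int a) * h_plus n (int b)
      - h_minus n (int a - 1) * h_plus n (int b - 1)) :: 'k laurent"
  let ?u = "\<lambda>i j. var_pow j (int (n - 1 - i)) :: 'k laurent"
  let ?l = "\<lambda>i. if i = 0 then int (b + n - 1) else if i = n - 1 then - int a else int (n - 1 - i)"
  have rho: "alternant n (rho n) = leibniz n ?u"
    unfolding alternant_eq_leibniz
    by (rule leibniz_cong) (simp add: rho_def of_nat_diff algebra_simps)
  have "alternant n (map2 (+) \<alpha> (rho n)) = leibniz n (\<lambda>i j. var_pow j (?l i + int a))"
    unfolding alternant_eq_leibniz
  proof (rule leibniz_cong)
    fix i j assume "i < n" "j < n"
    then have "map2 (+) \<alpha> (rho n) ! i = ?l i + int a"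
      using assms(1) len by (auto simp: rho_def \<alpha> of_nat_diff)
    then show "var_pow j (map2 (+) \<alpha> (rho n) ! i) = var_pow j (?l i + int a)" by simp
  qed
  also have "\<dots> = x_Pi n ^ a * leibniz n (\<lambda>i j. var_pow j (?l i))"
    by (rule leibniz_var_pow_add_const)
  also have "leibniz n (\<lambda>i j. var_pow j (?l i) :: 'k laurent)
      = leibniz n (?u(0 := (\<lambda>j. var_pow j (int (b + n - 1))), n - 1 := (\<lambda>j. var_pow j (- int a))))"
    by (rule leibniz_cong) (use assms(1) in auto)
  finally have "?s * alternant n (rho n) = alternant n (map2 (+) \<alpha> (rho n))"
    by (simp only: rho vandermonde_replace_outer_rows[OF assms(1)] mult.assoc)
  moreover have "?s \<in> laurent_ring n"
    unfolding x_Pi_def h_plus_def h_minus_def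
    by (intro laurent_ring_mult laurent_ring_power laurent_ring_diff laurent_ring_prod
        laurent_ring_complete_hom laurent_ring_var_pow) auto
  ultimately show "schur_laurent n \<alpha> = ?s" by (intro schur_laurent_eqI)
qed

end
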